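(* Let $E$ be a directed graph with no sinks and let $X_E\subseteq\Sigma_{E^1}$ be its edge shift. Then $X_E$ is a $1$-step shift.
   Context: Full shift: for a set $\mathcal{A}$ (alphabet), let $\mathcal{A}^0=\{\vec{0}\}$ ($\vec{0}$ the empty sequence), $\Sigma_{\mathcal{A}}^{\mathrm{fin}}=\bigcup_{k=0}^\infty\mathcal{A}^k$ (blocks) and $\Sigma_{\mathcal{A}}^{\mathrm{inf}}=\mathcal{A}^{\mathbb{N}}$, $\mathbb{N}=\{1,2,\ldots\}$; $l(x)$ is the length of a sequence. If $\mathcal{A}$ is infinite, $\Sigma_{\mathcal{A}}:=\Sigma_{\mathcal{A}}^{\mathrm{inf}}\sqcup\Sigma_{\mathcal{A}}^{\mathrm{fin}}$ with the quotient topology from the map $Q:\mathcal{A}_\infty\times\mathcal{A}_\infty\times\cdots\to\Sigma_{\mathcal{A}}$ that truncates a sequence just before the first occurrence of $\infty$, where $\mathcal{A}_\infty=\mathcal{A}\cup\{\infty\}$ is the one-point compactification of the discrete space $\mathcal{A}$ and the product has the product topology. If $\mathcal{A}$ is finite, $\Sigma_{\mathcal{A}}:=\mathcal{A}^{\mathbb{N}}$ with the product topology. For $\mathcal{F}\subseteq\Sigma_{\mathcal{A}}^{\mathrm{fin}}$: $X^{\mathrm{inf}}_{\mathcal{F}}:=\{x\in\Sigma_{\mathcal{A}}^{\mathrm{inf}}:\text{no subblock of }x\text{ is in }\mathcal{F}\}$ (a subblock is a finite block $u$ with $x=yuz$; the empty block is a subblock of every sequence), $X^{\mathrm{fin}}_{\mathcal{F}}:=\{x\in\Sigma_{\mathcal{A}}^{\mathrm{fin}}:\text{there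 are infinitely many }a\in\mathcal{A}\text{ for which there exists }y\in\Sigma_{\mathcal{A}}^{\mathrm{inf}}\text{ with }xay\in X^{\mathrm{inf}}_{\mathcal{F}}\}$, and $X_{\mathcal{F}}:=X^{\mathrm{inf}}_{\mathcal{F}}\cup X^{\mathrm{fin}}_{\mathcal{F}}$. For $M\in\mathbb{N}\cup\{0\}$, a shift space $X\subseteq\Sigma_{\mathcal{A}}$ is an $M$-step shift if $X=X_{\mathcal{F}}$ for some $\mathcal{F}\subseteq\Sigma_{\mathcal{A}}^{\mathrm{fin}}$ with $l(u)=M+1$ for all $u\in\mathcal{F}$. (A shift space is a closed set $X\subseteq\Sigma_{\mathcal{A}}$ with $\sigma(X)\subseteq X$, where $\sigma$ deletes the first entry and $\sigma(x)=\vec 0$ when $l(x)\le1$, such that for each finite $x\in X$ there are infinitely many $a\in\mathcal{A}$ with $xay\in X$ for some $y\in\Sigma_{\mathcal{A}}$.) A directed graph $E=(E^0,E^1,r,s)$ consists of countable sets $E^0$ (vertices), $E^1$ (edges) and range and source maps $r,s:E^1\to E^0$. A vertex $v$ is a sink if $s^{-1}(v)=\emptyset$. An infinite path is a sequence $e_1e_2\ldots$ of edges with $r(e_i)=s(e_{i+1})$ for all $i$; $E^\infty$ is the set of infinite paths. If $E$ has no sinks, its edge shift $X_E$ is the closure of $E^\infty$ in $\Sigma_{E^1}$. *)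

theory Defs
  imports
    "HOL-Analysis.Analysis"
    "HOL-Library.Omega_Words_Fun"
    "Graph_Theory.Digraph"
begin

text \<open>
  An alphabet is a set \<open>A :: 'a set\<close>. Infinite sequences are functions on \<open>nat\<close>, indexed from 0;
  \<open>Fin []\<close> is the empty sequence.
\<close>

datatype 'a symseq = Fin "'a list" | Inf "'a word"

definition inf_seqs :: "'a set \<Rightarrow> 'a word set" where
  "inf_seqs A = {x. \<forall>n. x n \<in> A}"

text \<open>The underlying set of the full shift; it contains finite sequences only if \<open>A\<close> is infinite.\<close>

definition full_shift :: "'a set \<Rightarrow> 'a symseq set" where
  "full_shift A = Inf ` inf_seqs A \<union> (if infinite A then Fin ` lists A else {})"

text \<open>The finest topology on \<open>f ` topspace T\<close> that makes \<open>f\<close> continuous.\<close>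

definition quotient_topology :: "'b topology \<Rightarrow> ('b \<Rightarrow> 'c) \<Rightarrow> 'c topology" where
  "quotient_topology T f =
     topology (\<lambda>U. U \<subseteq> f ` topspace T \<and> openin T {x \<in> topspace T. f x \<in> U})"

lemma openin_quotient_topology:
  "openin (quotient_topology T f) U \<longleftrightarrow>
     U \<subseteq> f ` topspace T \<and> openin T {x \<in> topspace T. f x \<in> U}"
proof -
  have "istopology (\<lambda>U. U \<subseteq> f ` topspace T \<and> openin T {x \<in> topspace T. f x \<in> U})"
    unfolding istopology_def
  proof (intro conjI allI impI, goal_cases)
    case (2 S U)
    have "{x \<in> topspace T. f x \<in> S \<inter> U}
        = {x \<in> topspace T. f x \<in> S} \<inter> {x \<in> topspace T. f x \<in> U}" by auto
    with 2 show ?case by auto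
  next
    case (4 K)
    have "{x \<in> topspace T. f x \<in> \<Union>K} = (\<Union>S\<in>K. {x \<in> topspace T. f x \<in> S})" by auto
    with 4 show ?case by auto
  qed auto
  then show ?thesis
    by (simp add: quotient_topology_def)
qed

lemma topspace_quotient_topology [simp]:
  "topspace (quotient_topology T f) = f ` topspace T"
proof
  show "topspace (quotient_topology T f) \<subseteq> f ` topspace T"
    by (meson openin_quotient_topology openin_topspace)
  have "{x \<in> topspace T. f x \<in> f ` topspace T} = topspace T" by auto
  then have "openin (quotient_topology T f) (f ` topspace T)"
    by (simp add: openin_quotient_topology)
  then show "f ` topspace T \<subseteq> topspace (quotient_topology T f)"
    by (rule openin_subset)
qed

lemma quotient_map_quotient_topology: "quotient_map T (quotient_topology T f) f"
  by (simp add: quotient_map_def openin_quotient_topology)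

text \<open>
  \<open>Alexandroff_compactification\<close> lives on the option type, so \<open>None\<close> plays the role of \<open>\<infinity>\<close>.
  The map \<open>truncate\<close> cuts a sequence just before the first \<open>None\<close>.
\<close>

definition truncate :: "(nat \<Rightarrow> 'a option) \<Rightarrow> 'a symseq" where
  "truncate x =
     (if \<exists>n. x n = None then Fin (map (\<lambda>i. the (x i)) [0..<(LEAST n. x n = None)])
      else Inf (\<lambda>i. the (x i)))"

text \<open>
  For finite \<open>A\<close> the map \<open>Inf\<close> is injective, and the quotient topology is just the product topology
  transported along it.
\<close>

definition full_shift_topology :: "'a set \<Rightarrow> 'a symseq topology" where
  "full_shift_topology A =
     (if infinite A
      then quotient_topology
             (product_topology
                (\<lambda>_::nat. Alexandroff_compactification (discrete_topology A)) UNIV)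
             truncate
      else quotient_topology (product_topology (\<lambda>_::nat. discrete_topology A) UNIV) Inf)"

lemma truncate_image:
  "truncate ` (UNIV \<rightarrow>\<^sub>E insert None (Some ` A)) = Inf ` inf_seqs A \<union> Fin ` lists A"
proof (intro equalityI subsetI)
  fix s assume "s \<in> truncate ` (UNIV \<rightarrow>\<^sub>E insert None (Some ` A))"
  then obtain x where s: "s = truncate x" and x: "\<And>n. x n \<in> insert None (Some ` A)"
    by auto
  have the: "the (x n) \<in> A" if "x n \<noteq> None" for n
    using x[of n] that by auto
  show "s \<in> Inf ` inf_seqs A \<union> Fin ` lists A"
  proof (cases "\<exists>n. x n = None")
    case True
    have "x i \<noteq> None" if "i < (LEAST n. x n = None)" for i
      using that not_less_Least by blast
    then have "map (\<lambda>i. the (x i)) [0..<(LEAST n. x n = None)] \<in> lists A"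
      using the by (auto simp: in_lists_conv_set)
    then show ?thesis
      using True s by (simp add: truncate_def)
  next
    case False
    then have "(\<lambda>i. the (x i)) \<in> inf_seqs A"
      using the by (auto simp: inf_seqs_def)
    then show ?thesis
      using False s by (simp add: truncate_def)
  qed
next
  fix s assume "s \<in> Inf ` inf_seqs A \<union> Fin ` lists A"
  then consider (I) y where "s = Inf y" "y \<in> inf_seqs A" | (F) w where "s = Fin w" "w \<in> lists A"
    by auto
  then show "s \<in> truncate ` (UNIV \<rightarrow>\<^sub>E insert None (Some ` A))"
  proof cases
    case I
    then have "s = truncate (\<lambda>i. Some (y i))"
      by (simp add: truncate_def)
    moreover have "(\<lambda>i. Some (y i)) \<in> (UNIV \<rightarrow>\<^sub>E insert None (Some ` A))"
      using I by (auto simp: inf_seqs_def)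
    ultimately show ?thesis by blast
  next
    case F
    define x where "x = (\<lambda>i. if i < length w then Some (w ! i) else None)"
    have "(LEAST n. x n = None) = length w"
      by (rule Least_equality) (auto simp: x_def split: if_splits)
    moreover have "x (length w) = None"
      by (simp add: x_def)
    moreover have "map (\<lambda>i. the (x i)) [0..<length w] = w"
      by (rule nth_equalityI) (auto simp: x_def)
    ultimately have "s = truncate x"
      using F by (auto simp: truncate_def)
    moreover have "x \<in> (UNIV \<rightarrow>\<^sub>E insert None (Some ` A))"
      using F by (auto simp: x_def in_lists_conv_set)
    ultimately show ?thesis by blast
  qed
qed

lemma topspace_full_shift_topology [simp]:
  "topspace (full_shift_topology A) = full_shift A"
proof (cases "infinite A")
  case True
  then show ?thesis
    by (simp add: full_shift_topology_def full_shift_def truncate_image)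
next
  case False
  have "(UNIV \<rightarrow>\<^sub>E A) = inf_seqs A"
    by (auto simp: inf_seqs_def)
  with False show ?thesis
    by (simp add: full_shift_topology_def full_shift_def)
qed

fun prepend :: "'a list \<Rightarrow> 'a symseq \<Rightarrow> 'a symseq" where
  "prepend u (Fin v) = Fin (u @ v)"
| "prepend u (Inf x) = Inf (u \<frown> x)"

fun shift_map :: "'a symseq \<Rightarrow> 'a symseq" where
  "shift_map (Fin u) = Fin (tl u)"
| "shift_map (Inf x) = Inf (suffix 1 x)"

definition shift_space :: "'a set \<Rightarrow> 'a symseq set \<Rightarrow> bool" where
  "shift_space A X \<longleftrightarrow>
     closedin (full_shift_topology A) X \<and>
     shift_map ` X \<subseteq> X \<and>
     (\<forall>x. Fin x \<in> X \<longrightarrow> infinite {a \<in> A. \<exists>y \<in> full_shift A. prepend (x @ [a]) y \<in> X})"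

definition subblock :: "'a list \<Rightarrow> 'a word \<Rightarrow> bool" where
  "subblock u x \<longleftrightarrow> (\<exists>y z. x = y \<frown> u \<frown> z)"

definition forbidden_inf :: "'a set \<Rightarrow> 'a list set \<Rightarrow> 'a word set" where
  "forbidden_inf A F = {x \<in> inf_seqs A. \<forall>u \<in> F. \<not> subblock u x}"

definition forbidden_fin :: "'a set \<Rightarrow> 'a list set \<Rightarrow> 'a list set" where
  "forbidden_fin A F =
     {x \<in> lists A. infinite {a \<in> A. \<exists>y \<in> inf_seqs A. (x @ [a]) \<frown> y \<in> forbidden_inf A F}}"

definition forbidden_shift :: "'a set \<Rightarrow> 'a list set \<Rightarrow> 'a symseq set" where
  "forbidden_shift A F = Inf ` forbidden_inf A F \<union> Fin ` forbidden_fin A F"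

definition step_shift :: "'a set \<Rightarrow> nat \<Rightarrow> 'a symseq set \<Rightarrow> bool" where
  "step_shift A M X \<longleftrightarrow>
     shift_space A X \<and>
     (\<exists>F \<subseteq> lists A. (\<forall>u \<in> F. length u = M + 1) \<and> X = forbidden_shift A F)"

text \<open>Source and range of an edge are its \<open>tail\<close> and \<open>head\<close>.\<close>

definition sink :: "('v, 'e) pre_digraph \<Rightarrow> 'v \<Rightarrow> bool" where
  "sink E v \<longleftrightarrow> v \<in> verts E \<and> out_arcs E v = {}"

definition infinite_paths :: "('v, 'e) pre_digraph \<Rightarrow> 'e word set" where
  "infinite_paths E = {e \<in> inf_seqs (arcs E). \<forall>i. head E (e i) = tail E (e (Suc i))}"

definition edge_shift :: "('v, 'e) pre_digraph \<Rightarrow> 'e symseq set" where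
  "edge_shift E = full_shift_topology (arcs E) closure_of (Inf ` infinite_paths E)"

end

theory Submission
  imports Defs
begin

text \<open>
  The infinite paths of \<open>E\<close> are exactly the infinite sequences avoiding the pairs \<open>[e, f]\<close> with
  \<open>head E e \<noteq> tail E f\<close>. It remains to see that, for any forbidden set \<open>F\<close>, the closure of the
  infinite part is the whole shift. A cylinder given by a word and finitely many letters excluded
  from the next position is open, and such cylinders separate \<open>X\<^sub>F\<close> from its complement. Conversely,
  let \<open>U\<close> be open and contain the finite word \<open>w\<close>. In the compact product space, the sequences
  extending \<open>w\<close> are covered by the preimage of \<open>U\<close> and the open sets ``the letter after \<open>w\<close> is
  \<open>a\<close>''; a finite subcover shows that \<open>U\<close> contains all extensions of \<open>w\<close> whose next letter
  avoids a finite set.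
\<close>

section \<open>Cylinders in the full shift and their openness\<close>

lemma Fin_in_full_shift: "Fin w \<in> full_shift A \<longleftrightarrow> infinite A \<and> w \<in> lists A"
  by (auto simp: full_shift_def)

lemma Inf_in_full_shift: "Inf x \<in> full_shift A \<longleftrightarrow> x \<in> inf_seqs A"
  by (auto simp: full_shift_def)

text \<open>The canonical preimage of a sequence under \<open>truncate\<close>: every position
  beyond the end of a finite word is filled with \<open>None\<close>. Finite and infinite sequences
  can thus be tested position by position in the same way.\<close>

fun letter :: "'a symseq \<Rightarrow> nat \<Rightarrow> 'a option" where
  "letter (Fin w) n = (if n < length w then Some (w ! n) else None)"
| "letter (Inf x) n = Some (x n)"

lemma letter_truncate:
  "letter (truncate z) n = (if \<exists>j\<le>n. z j = None then None else z n)"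
proof (cases "\<exists>j. z j = None")
  case True
  define m where "m = (LEAST j. z j = None)"
  have m: "z m = None"
    unfolding m_def using True by (rule LeastI_ex)
  have "(\<exists>j\<le>n. z j = None) \<longleftrightarrow> m \<le> n"
    using m by (auto simp: m_def intro: Least_le order_trans)
  moreover have "z n \<noteq> None" if "n < m"
    using that not_less_Least unfolding m_def by blast
  ultimately show ?thesis
    using True by (auto simp: truncate_def simp flip: m_def)
next
  case False
  then have "truncate z = Inf (\<lambda>i. the (z i))" "\<And>j. z j \<noteq> None"
    by (auto simp: truncate_def)
  then show ?thesis
    by (simp del: not_None_eq)
qed

text \<open>A sequence that stops right after \<open>w\<close> has \<open>None\<close> as its next
  letter and so passes the second test: \<open>Fin w\<close> itself belongs to the set as soon as it
  belongs to the full shift.\<close>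

definition cylinder :: "'a set \<Rightarrow> 'a list \<Rightarrow> 'a set \<Rightarrow> 'a symseq set" where
  "cylinder A w T =
     {s \<in> full_shift A. (\<forall>i<length w. letter s i = Some (w ! i)) \<and> letter s (length w) \<notin> Some ` T}"

text \<open>Turns the letterwise description into concatenations, the form in which forbidden shifts
  speak about their points.\<close>

lemma cylinder_cases:
  assumes "s \<in> cylinder A w T"
  obtains (end_here) "s = Fin w"
    | (Fin) a v where "s = Fin (w @ a # v)" "a \<in> A - T"
    | (Inf) a y where "s = Inf ((w @ [a]) \<frown> y)" "a \<in> A - T"
proof (cases s)
  case s: (Fin u)
  have u: "i < length u \<and> u ! i = w ! i" if "i < length w" for i
    using assms s that by (auto simp: cylinder_def split: if_splits)
  \<comment> \<open>If \<open>u\<close> were shorter than \<open>w\<close>, then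
    \<open>i = length u\<close> would give \<open>length u < length u\<close>.\<close>
  then have len: "length w \<le> length u"
    by (meson less_irrefl not_le)
  with u have "take (length w) u = w"
    by (intro nth_equalityI) auto
  then obtain v where v: "u = w @ v"
    by (metis append_take_drop_id)
  show ?thesis
  proof (cases v)
    case Nil
    with s v show ?thesis using end_here by simp
  next
    case (Cons a v')
    have "a \<in> A - T"
      using assms s v Cons by (auto simp: cylinder_def full_shift_def split: if_splits)
    with s v Cons show ?thesis using Fin by simp
  qed
next
  case s: (Inf x)
  have "prefix (length w) x = w"
    using assms s by (intro nth_equalityI) (auto simp: cylinder_def)
  \<comment> \<open>Cutting one position later than \<open>length w\<close> puts the next letter
    into the finite part.\<close>
  then have "x = (w @ [x (length w)]) \<frown> suffix (Suc (length w)) x"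
    using prefix_suffix[of x "Suc (length w)"] by simp
  moreover have "x (length w) \<in> A - T"
    using assms s by (auto simp: cylinder_def Inf_in_full_shift inf_seqs_def)
  ultimately show ?thesis
    using s Inf by blast
qed

text \<open>Neighbourhoods of the point at infinity are the complements of closed compact sets, and
  finite sets are compact.\<close>

lemma openin_Alexandroff_discrete_delete_finite:
  assumes "finite T" "T \<subseteq> A"
  shows "openin (Alexandroff_compactification (discrete_topology A))
           (insert None (Some ` A) - Some ` T)"
proof -
  have "compactin (discrete_topology A) T" "closedin (discrete_topology A) T"
    using assms finite_imp_compactin[of T "discrete_topology A"] by auto
  moreover have "insert None (Some ` A) - Some ` T = insert None (Some ` (A - T))"
    by auto
  ultimately show ?thesis
    by (auto simp: openin_Alexandroff_compactification)
qed

text \<open>The preimage under the quotient map is a box restricted in finitely many coordinates: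
  singletons for the letters of \<open>w\<close>, then the complement of \<open>T\<close>, then
  whole factors.\<close>

lemma openin_cylinder:
  assumes w: "w \<in> lists A" and T: "finite T" "T \<subseteq> A"
  shows "openin (full_shift_topology A) (cylinder A w T)"
proof -
  have wA: "w ! i \<in> A" if "i < length w" for i
    using w that by (simp add: in_lists_conv_set)
  show ?thesis
  proof (cases "infinite A")
    case True
    let ?X = "Alexandroff_compactification (discrete_topology A)"
    define V where "V = (\<lambda>i. if i < length w then {Some (w ! i)}
                              else if i = length w then insert None (Some ` A) - Some ` T
                              else insert None (Some ` A))"
    have "openin ?X {Some (w ! i)}" if "i < length w" for i
      using wA[OF that] openin_Alexandroff_compactification_image_Some[of "discrete_topology A" "{w ! i}"]
      by simp
    then have "openin ?X (V i)" for i
      using openin_Alexandroff_discrete_delete_finite[OF T]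
        openin_topspace[of ?X]
      by (simp add: V_def)
    moreover have "finite {i. V i \<noteq> topspace ?X}"
      by (rule finite_subset[of _ "{..length w}"]) (auto simp: V_def split: if_splits)
    ultimately have "openin (product_topology (\<lambda>_. ?X) UNIV) (Pi\<^sub>E UNIV V)"
      by (intro product_topology_basis)
    \<comment> \<open>Once the letters of \<open>w\<close> are in place, no \<open>None\<close>
      occurs before position \<open>length w\<close>, so truncation preserves the entry there and
      the box is the exact preimage of the cylinder.\<close>
    moreover have "Pi\<^sub>E UNIV V =
        {z \<in> topspace (product_topology (\<lambda>_. ?X) UNIV). truncate z \<in> cylinder A w T}"
      (is "_ = ?P")
    proof (intro equalityI subsetI)
      fix z assume "z \<in> Pi\<^sub>E UNIV V"
      then have zV: "z i \<in> V i" for i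
        by auto
      then have top: "z \<in> UNIV \<rightarrow>\<^sub>E insert None (Some ` A)"
      proof -
        have "V i \<subseteq> insert None (Some ` A)" for i
          using wA by (auto simp: V_def)
        with zV show ?thesis by blast
      qed
      have zw: "z i = Some (w ! i)" if "i < length w" for i
        using zV[of i] that by (simp add: V_def)
      then have "\<forall>i<length w. letter (truncate z) i = Some (w ! i)"
        by (force simp: letter_truncate)
      moreover have "letter (truncate z) (length w) \<notin> Some ` T"
        using zV[of "length w"] by (simp add: letter_truncate V_def)
      moreover have "truncate z \<in> full_shift A"
        using top truncate_image[of A] True by (auto simp: full_shift_def)
      ultimately show "z \<in> ?P"
        using top by (simp add: cylinder_def)
    next
      fix z assume z: "z \<in> ?P"
      then have top: "z i \<in> insert None (Some ` A)" for i
        by auto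
      have zw: "z i = Some (w ! i)" if "i < length w" for i
      proof -
        have "letter (truncate z) i = Some (w ! i)"
          using z that by (simp add: cylinder_def)
        then show ?thesis
          by (simp add: letter_truncate split: if_splits)
      qed
      have "z (length w) \<notin> Some ` T"
      proof (cases "z (length w) = None")
        case False
        then have "\<forall>j\<le>length w. z j \<noteq> None"
          using zw by (metis le_neq_implies_less option.distinct(1))
        then show ?thesis
          using z by (auto simp: cylinder_def letter_truncate)
      qed auto
      then show "z \<in> Pi\<^sub>E UNIV V"
        using top zw by (auto simp: V_def)
    qed
    moreover have "cylinder A w T \<subseteq> full_shift A"
      by (auto simp: cylinder_def)
    ultimately show ?thesis
      using True
      by (simp add: full_shift_topology_def full_shift_def openin_quotient_topology truncate_image)
  next
    case False
    define V where "V = (\<lambda>i. if i < length w then {w ! i}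
                              else if i = length w then A - T else A)"
    have "openin (discrete_topology A) (V i)" for i
      using wA by (auto simp: V_def)
    moreover have "finite {i. V i \<noteq> topspace (discrete_topology A)}"
      by (rule finite_subset[of _ "{..length w}"]) (auto simp: V_def split: if_splits)
    ultimately have "openin (product_topology (\<lambda>_. discrete_topology A) UNIV) (Pi\<^sub>E UNIV V)"
      by (intro product_topology_basis)
    moreover have "x \<in> Pi\<^sub>E UNIV V \<longleftrightarrow> x \<in> (UNIV \<rightarrow>\<^sub>E A) \<and> Inf x \<in> cylinder A w T" for x
    proof -
      \<comment> \<open>Beyond position \<open>length w\<close> the box only asks for letters of
        \<open>A\<close>, so the positions up to \<open>length w\<close> decide.\<close>
      have "V i \<subseteq> A" for i
        using wA by (auto simp: V_def)
      moreover have "V i = A" if "length w < i" for i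
        using that by (simp add: V_def)
      ultimately have "(\<forall>i. x i \<in> V i) \<longleftrightarrow>
          (\<forall>i. x i \<in> A) \<and> (\<forall>i<length w. x i \<in> V i) \<and> x (length w) \<in> V (length w)"
        by (metis linorder_neqE_nat subsetD)
      also have "\<dots> \<longleftrightarrow> (\<forall>i. x i \<in> A) \<and> Inf x \<in> cylinder A w T"
        by (auto simp: V_def cylinder_def Inf_in_full_shift inf_seqs_def)
      finally show ?thesis
        by (simp add: PiE_iff)
    qed
    then have "Pi\<^sub>E UNIV V = {x \<in> UNIV \<rightarrow>\<^sub>E A. Inf x \<in> cylinder A w T}"
      by blast
    moreover have "cylinder A w T \<subseteq> Inf ` (UNIV \<rightarrow>\<^sub>E A)"
      using False by (auto simp: cylinder_def full_shift_def inf_seqs_def)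
    ultimately show ?thesis
      using False by (simp add: full_shift_topology_def openin_quotient_topology)
  qed
qed

section \<open>Neighbourhoods of a finite word\<close>

lemma truncate_eq_Fin:
  assumes "\<And>i. i < length w \<Longrightarrow> z i = Some (w ! i)" "z (length w) = None"
  shows "truncate z = Fin w"
proof -
  have "(LEAST n. z n = None) = length w"
    using assms by (intro Least_equality) (force simp: not_le[symmetric])+
  then show ?thesis
    using assms by (auto simp: truncate_def intro: nth_equalityI)
qed

text \<open>Compactness is what makes the excluded set \<open>T\<close> finite. The conclusion
  speaks of infinite extensions because the closure argument looks for infinite points in
  \<open>U\<close>.\<close>

lemma open_nbhd_Fin_contains_cylinder:
  assumes "infinite A" and w: "w \<in> lists A"
    and U: "openin (full_shift_topology A) U" "Fin w \<in> U"
  obtains T where "finite T" "\<And>a y. a \<in> A - T \<Longrightarrow> y \<in> inf_seqs A \<Longrightarrow> Inf ((w @ [a]) \<frown> y) \<in> U"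
proof -
  let ?X = "Alexandroff_compactification (discrete_topology A)"
  let ?Y = "product_topology (\<lambda>_::nat. ?X) UNIV"
  define Q where "Q = {z \<in> topspace ?Y. truncate z \<in> U}"
  define B where "B = (\<lambda>a. {z \<in> topspace ?Y. z (length w) \<in> Some ` {a}})"
  \<comment> \<open>The sequences beginning with \<open>w\<close>, as a product of singletons and
    compact factors; Tychonoff makes it compact.\<close>
  define K where "K = Pi\<^sub>E UNIV (\<lambda>i. if i < length w then Some ` {w ! i} else topspace ?X)"
  have wA: "w ! i \<in> A" if "i < length w" for i
    using w that by (simp add: in_lists_conv_set)
  have Q: "openin ?Y Q"
    using U \<open>infinite A\<close> by (simp add: Q_def full_shift_topology_def openin_quotient_topology)
  have B: "openin ?Y (B a)" if "a \<in> A" for a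
  proof -
    have "openin ?X (Some ` {a})"
      using that by (subst openin_Alexandroff_compactification_image_Some) simp
    then show ?thesis
      unfolding B_def
      by (rule openin_continuous_map_preimage[OF continuous_map_product_projection, rotated]) simp
  qed
  have "compactin ?X (Some ` {w ! i})" if "i < length w" for i
    using wA[OF that] by (intro finite_imp_compactin) auto
  then have K: "compactin ?Y K"
    using compact_space_Alexandroff_compactification[of "discrete_topology A"]
    by (auto simp: K_def compactin_PiE compact_space_def)
  \<comment> \<open>The entry after \<open>w\<close> decides: with \<open>None\<close> the sequence
    truncates to \<open>Fin w\<close>, which lies in \<open>U\<close>; with a letter
    \<open>a\<close> it lies in \<open>B a\<close>.\<close>
  have "K \<subseteq> \<Union>(insert Q (B ` A))"
  proof
    fix z assume z: "z \<in> K"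
    have top: "z \<in> topspace ?Y"
      using compactin_subset_topspace[OF K] z by blast
    have zw: "z i = Some (w ! i)" if "i < length w" for i
      using z that by (auto simp: K_def PiE_iff dest: spec[of _ i])
    show "z \<in> \<Union>(insert Q (B ` A))"
    proof (cases "z (length w)")
      case None
      then have "truncate z = Fin w"
        using zw by (rule truncate_eq_Fin[rotated])
      with U top show ?thesis
        by (simp add: Q_def)
    next
      case (Some a)
      then have "a \<in> A"
        using top by (auto simp: PiE_iff dest: spec[of _ "length w"])
      with Some top show ?thesis
        by (auto simp: B_def)
    qed
  qed
  moreover have "\<forall>V\<in>insert Q (B ` A). openin ?Y V"
    using Q B by blast
  ultimately obtain \<F> where \<F>: "finite \<F>" "\<F> \<subseteq> insert Q (B ` A)" "K \<subseteq> \<Union>\<F>"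
    using K unfolding compactin_def by meson
  \<comment> \<open>Apart from \<open>Q\<close>, the subcover consists of finitely many sets
    \<open>B a\<close>; their letters form \<open>T\<close>.\<close>
  then have "finite (\<F> - {Q})" "\<F> - {Q} \<subseteq> B ` A"
    by auto
  then obtain T where T: "finite T" "\<F> - {Q} = B ` T"
    by (meson finite_subset_image)
  show thesis
  proof
    fix a y assume a: "a \<in> A - T" and y: "y \<in> inf_seqs A"
    \<comment> \<open>This sequence lies in \<open>K\<close>, but its entry after \<open>w\<close>
      keeps it out of \<open>B t\<close> for every \<open>t\<close> in \<open>T\<close>, so only
      \<open>Q\<close> can cover it.\<close>
    define z where "z = (\<lambda>i. Some (((w @ [a]) \<frown> y) i))"
    have "((w @ [a]) \<frown> y) i \<in> A" for i
      using wA a y by (auto simp: conc_def nth_append inf_seqs_def)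
    then have "z \<in> K"
      by (auto simp: K_def z_def conc_def nth_append)
    moreover have "z (length w) = Some a"
      by (simp add: z_def conc_def)
    then have "z \<notin> \<Union>(B ` T)"
      using a by (auto simp: B_def)
    ultimately have "z \<in> Q"
      using \<F> T by blast
    then show "Inf ((w @ [a]) \<frown> y) \<in> U"
      by (simp add: Q_def z_def truncate_def)
  qed (fact T)
qed

section \<open>Tails and extensions of points of a forbidden shift\<close>

lemma forbidden_inf_suffix:
  assumes "x \<in> forbidden_inf A F"
  shows "suffix n x \<in> forbidden_inf A F"
proof -
  have "subblock u x" if sub: "subblock u (suffix n x)" for u
  proof -
    obtain y z where "suffix n x = y \<frown> u \<frown> z"
      using sub unfolding subblock_def by blast
    \<comment> \<open>The deleted letters are put back in front, so an occurrence in the tail is an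
      occurrence in \<open>x\<close>.\<close>
    then have "x = (prefix n x @ y) \<frown> u \<frown> z"
      using prefix_suffix[of x n] by simp
    then show ?thesis
      unfolding subblock_def by blast
  qed
  then show ?thesis
    using assms by (auto simp: forbidden_inf_def inf_seqs_def)
qed

text \<open>Every letter that may follow \<open>x\<close> may also follow \<open>tl x\<close>, so
  there are still infinitely many of them.\<close>

lemma forbidden_fin_tl:
  assumes "x \<in> forbidden_fin A F"
  shows "tl x \<in> forbidden_fin A F"
proof (cases x)
  case (Cons b v)
  have "{a \<in> A. \<exists>y\<in>inf_seqs A. (x @ [a]) \<frown> y \<in> forbidden_inf A F}
     \<subseteq> {a \<in> A. \<exists>y\<in>inf_seqs A. (v @ [a]) \<frown> y \<in> forbidden_inf A F}"
  proof clarify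
    fix a y assume "y \<in> inf_seqs A" "(x @ [a]) \<frown> y \<in> forbidden_inf A F"
    moreover have "suffix 1 ((x @ [a]) \<frown> y) = (v @ [a]) \<frown> y"
      using Cons by (auto simp: conc_def suffix_def fun_eq_iff)
    ultimately show "\<exists>y\<in>inf_seqs A. (v @ [a]) \<frown> y \<in> forbidden_inf A F"
      using forbidden_inf_suffix by metis
  qed
  with assms Cons show ?thesis
    by (auto simp: forbidden_fin_def dest: infinite_super)
qed (use assms in simp)

text \<open>An infinite set of possible next letters is nonempty. This lets finite points be traded
  for infinite ones.\<close>

lemma forbidden_fin_extend:
  assumes "x \<in> forbidden_fin A F"
  obtains y where "x \<frown> y \<in> forbidden_inf A F"
proof -
  have "{a \<in> A. \<exists>y\<in>inf_seqs A. (x @ [a]) \<frown> y \<in> forbidden_inf A F} \<noteq> {}"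
    using assms unfolding forbidden_fin_def by (intro infinite_imp_nonempty) blast
  then obtain a y where "(x @ [a]) \<frown> y \<in> forbidden_inf A F"
    by blast
  then show thesis
    using that[of "[a] \<frown> y"] by (simp only: conc_conc)
qed

text \<open>A finite point reaching beyond \<open>w\<close> extends to an infinite one with the same
  letter after \<open>w\<close>. Only the point \<open>Fin w\<close> has to be treated
  apart.\<close>

lemma cylinder_forbidden_shift_cases:
  assumes "s \<in> cylinder A w T" "s \<in> forbidden_shift A F"
  obtains "s = Fin w" "w \<in> forbidden_fin A F"
    | a y where "a \<in> A - T" "(w @ [a]) \<frown> y \<in> forbidden_inf A F"
  using assms(1)
proof (cases rule: cylinder_cases)
  case end_here
  with assms(2) that(1) show ?thesis by (auto simp: forbidden_shift_def)
next
  case (Fin a v)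
  then have "(w @ [a]) @ v \<in> forbidden_fin A F"
    using assms(2) by (auto simp: forbidden_shift_def)
  then obtain y where "((w @ [a]) @ v) \<frown> y \<in> forbidden_inf A F"
    by (rule forbidden_fin_extend)
  then have "(w @ [a]) \<frown> (v \<frown> y) \<in> forbidden_inf A F"
    by (simp only: conc_conc)
  with Fin that(2) show ?thesis by blast
next
  case (Inf a y)
  with assms(2) that(2) show ?thesis by (auto simp: forbidden_shift_def)
qed

section \<open>Topology of forbidden shifts\<close>

lemma forbidden_fin_finite_alphabet: "finite A \<Longrightarrow> forbidden_fin A F = {}"
  by (auto simp: forbidden_fin_def)

lemma forbidden_shift_subset_full_shift: "forbidden_shift A F \<subseteq> full_shift A"
proof (cases "finite A")
  case True
  then show ?thesis
    by (auto simp: forbidden_shift_def full_shift_def forbidden_inf_def forbidden_fin_finite_alphabet)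
next
  case False
  then show ?thesis
    by (auto simp: forbidden_shift_def full_shift_def forbidden_inf_def forbidden_fin_def)
qed

lemma closedin_forbidden_shift: "closedin (full_shift_topology A) (forbidden_shift A F)"
proof -
  have "\<exists>V. openin (full_shift_topology A) V \<and> s \<in> V \<and> V \<subseteq> full_shift A - forbidden_shift A F"
    if s: "s \<in> full_shift A - forbidden_shift A F" for s
  proof -
    have "\<exists>w T. w \<in> lists A \<and> finite T \<and> T \<subseteq> A \<and> s \<in> cylinder A w T
            \<and> cylinder A w T \<inter> forbidden_shift A F = {}"
    proof (cases s)
      case (Fin w)
      then have w: "w \<in> lists A" "w \<notin> forbidden_fin A F"
        using s by (auto simp: Fin_in_full_shift forbidden_shift_def)
      \<comment> \<open>The letters that may follow \<open>w\<close>; they are finitely many because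
        \<open>w\<close> is not in \<open>forbidden_fin A F\<close>. Excluding them keeps
        \<open>Fin w\<close> in the cylinder and removes every point of the shift.\<close>
      define T where "T = {a \<in> A. \<exists>y\<in>inf_seqs A. (w @ [a]) \<frown> y \<in> forbidden_inf A F}"
      have "finite T"
        using w by (auto simp: T_def forbidden_fin_def)
      moreover have "s \<in> cylinder A w T"
        using s Fin by (auto simp: cylinder_def)
      moreover have False if "t \<in> cylinder A w T" "t \<in> forbidden_shift A F" for t
        using that
      proof (cases rule: cylinder_forbidden_shift_cases)
        case 1
        with w show False by simp
      next
        case (2 a y)
        \<comment> \<open>Membership of \<open>a\<close> in \<open>T\<close> needs a witness in
          \<open>inf_seqs A\<close>; \<open>y\<close> is one, being a tail of an allowed
          sequence.\<close>
        then have "y \<in> inf_seqs A"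
          using forbidden_inf_suffix[of _ A F "length (w @ [a])"]
          by (metis (no_types, lifting) forbidden_inf_def mem_Collect_eq suffix_conc_length)
        with 2 show False by (auto simp: T_def)
      qed
      ultimately show ?thesis
        using w by (intro exI[of _ w] exI[of _ T]) (auto simp: T_def)
    next
      case (Inf x)
      then obtain u where x: "x \<in> inf_seqs A" and u: "u \<in> F" "subblock u x"
        using s by (auto simp: Inf_in_full_shift forbidden_shift_def forbidden_inf_def)
      \<comment> \<open>Cut \<open>x\<close> right behind a forbidden block: whatever begins with
        \<open>v @ u\<close> contains \<open>u\<close>, so no next letter has to be
        excluded.\<close>
      then obtain v z where vz: "x = (v @ u) \<frown> z"
        by (auto simp: subblock_def)
      have nope: "(v @ u) \<frown> y \<notin> forbidden_inf A F" for y
        using u by (auto simp: forbidden_inf_def subblock_def simp flip: conc_conc)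
      have "set (v @ u) \<subseteq> range x"
        unfolding vz range_conc by blast
      then have "v @ u \<in> lists A"
        using x by (auto simp: inf_seqs_def in_lists_conv_set)
      moreover have "s \<in> cylinder A (v @ u) {}"
        using s Inf vz by (simp add: cylinder_def)
      moreover have False if "t \<in> cylinder A (v @ u) {}" "t \<in> forbidden_shift A F" for t
        using that
      proof (cases rule: cylinder_forbidden_shift_cases)
        case 1
        with nope forbidden_fin_extend show False by metis
      next
        case (2 a y)
        with nope[of "[a] \<frown> y"] show False by (metis conc_conc)
      qed
      ultimately show ?thesis
        by (intro exI[of _ "v @ u"] exI[of _ "{}"]) auto
    qed
    then show ?thesis
    proof (elim exE conjE, intro exI conjI)
      fix w T assume "w \<in> lists A" "finite T" "T \<subseteq> A" "s \<in> cylinder A w T"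
        and disj: "cylinder A w T \<inter> forbidden_shift A F = {}"
      then show "openin (full_shift_topology A) (cylinder A w T)" "s \<in> cylinder A w T"
        by (simp_all add: openin_cylinder)
      show "cylinder A w T \<subseteq> full_shift A - forbidden_shift A F"
        using disj by (auto simp: cylinder_def)
    qed
  qed
  then have "openin (full_shift_topology A) (full_shift A - forbidden_shift A F)"
    by (subst openin_subopen) blast
  then show ?thesis
    by (simp add: closedin_def forbidden_shift_subset_full_shift)
qed

text \<open>One inclusion is closedness. For the other, a neighbourhood of \<open>Fin w\<close> can
  rule out only finitely many next letters, while infinitely many lead to sequences in
  \<open>forbidden_inf A F\<close>.\<close>

lemma closure_of_forbidden_inf:
  "full_shift_topology A closure_of (Inf ` forbidden_inf A F) = forbidden_shift A F"
proof
  show "full_shift_topology A closure_of (Inf ` forbidden_inf A F) \<subseteq> forbidden_shift A F"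
    by (intro closure_of_minimal closedin_forbidden_shift) (simp add: forbidden_shift_def)
  have "Inf ` forbidden_inf A F \<subseteq> full_shift_topology A closure_of (Inf ` forbidden_inf A F)"
    by (rule closure_of_subset) (auto simp: full_shift_def forbidden_inf_def)
  moreover have "Fin w \<in> full_shift_topology A closure_of (Inf ` forbidden_inf A F)"
    if w: "w \<in> forbidden_fin A F" for w
    unfolding in_closure_of
  proof (intro conjI allI impI; (elim conjE)?)
    have "infinite A"
      using w forbidden_fin_finite_alphabet by blast
    moreover have "w \<in> lists A"
      using w by (simp add: forbidden_fin_def)
    ultimately show "Fin w \<in> topspace (full_shift_topology A)"
      by (simp add: Fin_in_full_shift)
    fix U assume "Fin w \<in> U" "openin (full_shift_topology A) U"
    then obtain T where "finite T"
      and T: "\<And>a y. a \<in> A - T \<Longrightarrow> y \<in> inf_seqs A \<Longrightarrow> Inf ((w @ [a]) \<frown> y) \<in> U"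
      using open_nbhd_Fin_contains_cylinder[OF \<open>infinite A\<close> \<open>w \<in> lists A\<close>] by metis
    have "infinite {a \<in> A. \<exists>y\<in>inf_seqs A. (w @ [a]) \<frown> y \<in> forbidden_inf A F}"
      using w by (simp add: forbidden_fin_def)
    then have "{a \<in> A. \<exists>y\<in>inf_seqs A. (w @ [a]) \<frown> y \<in> forbidden_inf A F} - T \<noteq> {}"
      using \<open>finite T\<close> by (intro infinite_imp_nonempty Diff_infinite_finite)
    then obtain a y where "a \<in> A - T" "y \<in> inf_seqs A" "(w @ [a]) \<frown> y \<in> forbidden_inf A F"
      by blast
    with T show "\<exists>s. s \<in> Inf ` forbidden_inf A F \<and> s \<in> U"
      by blast
  qed
  ultimately show "forbidden_shift A F
      \<subseteq> full_shift_topology A closure_of (Inf ` forbidden_inf A F)"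
    by (auto simp: forbidden_shift_def)
qed

text \<open>The extension condition is built into \<open>forbidden_fin\<close>, since an infinite
  continuation is in particular one in the full shift.\<close>

lemma shift_space_forbidden_shift: "shift_space A (forbidden_shift A F)"
  unfolding shift_space_def
proof (intro conjI allI impI)
  show "shift_map ` forbidden_shift A F \<subseteq> forbidden_shift A F"
    by (auto simp: forbidden_shift_def forbidden_inf_suffix forbidden_fin_tl simp del: One_nat_def)
next
  fix x assume "Fin x \<in> forbidden_shift A F"
  then have "infinite {a \<in> A. \<exists>y\<in>inf_seqs A. (x @ [a]) \<frown> y \<in> forbidden_inf A F}"
    by (auto simp: forbidden_shift_def forbidden_fin_def)
  moreover have "{a \<in> A. \<exists>y\<in>inf_seqs A. (x @ [a]) \<frown> y \<in> forbidden_inf A F}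
      \<subseteq> {a \<in> A. \<exists>y\<in>full_shift A. prepend (x @ [a]) y \<in> forbidden_shift A F}"
  proof clarify
    fix a y assume "y \<in> inf_seqs A" "(x @ [a]) \<frown> y \<in> forbidden_inf A F"
    then show "\<exists>y\<in>full_shift A. prepend (x @ [a]) y \<in> forbidden_shift A F"
      by (intro bexI[of _ "Inf y"]) (auto simp: forbidden_shift_def Inf_in_full_shift)
  qed
  ultimately show "infinite {a \<in> A. \<exists>y\<in>full_shift A. prepend (x @ [a]) y \<in> forbidden_shift A F}"
    by (rule infinite_super[rotated])
qed (rule closedin_forbidden_shift)

section \<open>Edge shifts\<close>

lemma subblock_pair: "subblock [a, b] x \<longleftrightarrow> (\<exists>i. x i = a \<and> x (Suc i) = b)"
proof
  assume "subblock [a, b] x"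
  then obtain y z where "x = y \<frown> [a, b] \<frown> z"
    by (auto simp: subblock_def)
  then have "x (length y) = a \<and> x (Suc (length y)) = b"
    by (simp add: conc_def nth_append)
  then show "\<exists>i. x i = a \<and> x (Suc i) = b" ..
next
  assume "\<exists>i. x i = a \<and> x (Suc i) = b"
  then obtain i where "x i = a" "x (Suc i) = b" by blast
  then have "x = prefix i x \<frown> [a, b] \<frown> suffix (Suc (Suc i)) x"
    using prefix_suffix[of x i] by auto
  then show "subblock [a, b] x"
    by (metis subblock_def)
qed

text \<open>The path condition links neighbouring edges only, so each violation is a block of length
  two, and its entries are arcs because the sequence is over \<open>arcs E\<close>.\<close>

lemma infinite_paths_eq_forbidden_inf:
  "infinite_paths E =
     forbidden_inf (arcs E) {[e, f] | e f. e \<in> arcs E \<and> f \<in> arcs E \<and> head E e \<noteq> tail E f}"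
proof -
  have "(\<forall>e f. e \<in> arcs E \<and> f \<in> arcs E \<and> head E e \<noteq> tail E f \<longrightarrow> \<not> subblock [e, f] x)
    \<longleftrightarrow> (\<forall>i. head E (x i) = tail E (x (Suc i)))" if "x \<in> inf_seqs (arcs E)" for x
    using that unfolding inf_seqs_def subblock_pair by blast
  then show ?thesis
    unfolding infinite_paths_def forbidden_inf_def by blast
qed

theorem proposition5p16:
  fixes E :: "('v, 'e) pre_digraph"
  assumes "wf_digraph E"
    and "countable (verts E)"
    and "countable (arcs E)"
    and "\<And>v. v \<in> verts E \<Longrightarrow> \<not> sink E v"
  shows "step_shift (arcs E) 1 (edge_shift E)"
proof -
  define F where "F = {[e, f] | e f. e \<in> arcs E \<and> f \<in> arcs E \<and> head E e \<noteq> tail E f}"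
  \<comment> \<open>The closure of the paths is the closure of the infinite part of the forbidden
    shift, hence the whole of it.\<close>
  have "edge_shift E = forbidden_shift (arcs E) F"
    by (simp add: edge_shift_def infinite_paths_eq_forbidden_inf closure_of_forbidden_inf F_def)
  moreover have "F \<subseteq> lists (arcs E)" "\<forall>u\<in>F. length u = 1 + 1"
    by (auto simp: F_def)
  ultimately show ?thesis
    unfolding step_shift_def by (metis shift_space_forbidden_shift)
qed

end
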